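(* Let $\mathcal{H}$ be a Hilbert space over $\mathbb{K}\in\{\mathbb{R},\mathbb{C}\}$ of finite dimension $d$, let $(\Omega,\mu)$ be a measure space, and let $\{\tau_\alpha\}_{\alpha\in\Omega}$ be a normalized continuous Bessel family for $\mathcal{H}$. If the diagonal $\Delta:=\{(\alpha,\alpha):\alpha\in\Omega\}$ is measurable in the measure space $\Omega\times\Omega$, then $$\int_{\Omega\times\Omega}|\langle\tau_\alpha,\tau_\beta\rangle|^{2m}\,d(\mu\times\mu)(\alpha,\beta)=\int_\Omega\int_\Omega|\langle\tau_\alpha,\tau_\beta\rangle|^{2m}\,d\mu(\alpha)\,d\mu(\beta)\ \ge\ \frac{\mu(\Omega)^2}{\binom{d+m-1}{m}},\quad\forall m\in\mathbb{N}.$$ Equality holds in this inequality if and only if $\{\tau_\alpha\}_{\alpha\in\Omega}$ is a tight continuous frame. Further, one has the higher order continuous Welch bounds $$\sup_{\alpha,\beta\in\Omega,\ \alpha\ne\beta}|\langle\tau_\alpha,\tau_\beta\rangle|^{2m}\ \ge\ \frac{1}{(\mu\times\mu)((\Omega\times\Omega)\setminus\Delta)}\left[\frac{\mu(\Omega)^2}{\binom{d+m-1}{m}}-(\mu\times\mu)(\Delta)\right],\quad\forall m\in\mathbb{N}.$$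
   Context: A collection $\{\tau_\alpha\}_{\alpha\in\Omega}$ in a finite-dimensional Hilbert space $\mathcal{H}$ over $\mathbb{K}$ is a continuous Bessel family for $\mathcal{H}$ if (i) for each $h\in\mathcal{H}$ the map $\Omega\ni\alpha\mapsto\langle h,\tau_\alpha\rangle\in\mathbb{K}$ is measurable, and (ii) there is $b>0$ with $\int_\Omega|\langle h,\tau_\alpha\rangle|^2\,d\mu(\alpha)\le b\|h\|^2$ for all $h\in\mathcal{H}$. It is a continuous frame for $\mathcal{H}$ if moreover there is $a>0$ with $a\|h\|^2\le\int_\Omega|\langle h,\tau_\alpha\rangle|^2\,d\mu(\alpha)$ for all $h\in\mathcal{H}$; it is a tight continuous frame if one can take $a=b$. It is normalized if $\|\tau_\alpha\|=1$ for all $\alpha\in\Omega$. $\mu\times\mu$ is the product measure on $\Omega\times\Omega$.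
   Formalization: Equality clause corrected: for μ(Ω)≠0, equality implies tight for each m≥1; "iff" is stated only if m=1 or d=1, as an orthonormal basis with counting measure is tight without equality for d,m≥2. The sup bound assumes (μ×μ)((Ω×Ω)∖Δ)≠0. *)

theory Defs
  imports "HOL-Analysis.Analysis"
begin

text \<open>
  The scalar field \<open>K\<close>. Up to isometric isomorphism the class has exactly two models, the reals
  and the complex numbers: \<open>to_complex\<close> identifies the type isometrically with a subfield of the
  complex numbers that is either the real line or everything. The topology, and with it the Borel
  sets, comes from the norm.
\<close>

class real_or_complex = real_normed_field +
  fixes to_complex :: "'a \<Rightarrow> complex"
  assumes to_complex_add: "to_complex (x + y) = to_complex x + to_complex y"
    and to_complex_mult: "to_complex (x * y) = to_complex x * to_complex y"
    and to_complex_scaleR: "to_complex (scaleR r x) = scaleR r (to_complex x)"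
    and norm_to_complex: "norm (to_complex x) = norm x"
    and range_to_complex: "range to_complex = \<real> \<or> range to_complex = UNIV"

instantiation real :: real_or_complex
begin
definition to_complex_real :: "real \<Rightarrow> complex" where "to_complex_real = complex_of_real"
instance
  by standard (auto simp: to_complex_real_def scaleR_conv_of_real Reals_def)
end

instantiation complex :: real_or_complex
begin
definition to_complex_complex :: "complex \<Rightarrow> complex" where "to_complex_complex = (\<lambda>z. z)"
instance
  by standard (auto simp: to_complex_complex_def)
end

text \<open>
  The inner product is linear in its first argument and takes values in \<open>K\<close>. Completeness is not
  listed because it is automatic in finite dimension. Without \<open>finite_dim\<close> the library's \<open>dim\<close>
  would carry no information.
\<close>

locale finite_dim_hilbert_space = vector_space scale
  for scale :: "'k::real_or_complex \<Rightarrow> 'h::ab_group_add \<Rightarrow> 'h" +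
  fixes ip :: "'h \<Rightarrow> 'h \<Rightarrow> 'k"
  assumes finite_dim: "\<exists>B. finite B \<and> span B = UNIV"
    and ip_add_left: "ip (x + y) z = ip x z + ip y z"
    and ip_scale_left: "ip (scale c x) y = c * ip x y"
    and ip_conj_sym: "to_complex (ip y x) = cnj (to_complex (ip x y))"
    and ip_pos: "x \<noteq> 0 \<Longrightarrow> 0 < Re (to_complex (ip x x))"

definition ip_norm :: "('h \<Rightarrow> 'h \<Rightarrow> 'k::real_or_complex) \<Rightarrow> 'h \<Rightarrow> real" where
  "ip_norm ip x = sqrt (Re (to_complex (ip x x)))"

definition frame_integral ::
  "'a measure \<Rightarrow> ('h \<Rightarrow> 'h \<Rightarrow> 'k::real_or_complex) \<Rightarrow> ('a \<Rightarrow> 'h) \<Rightarrow> 'h \<Rightarrow> ennreal" where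
  "frame_integral M ip \<tau> h = (\<integral>\<^sup>+\<alpha>. ennreal ((norm (ip h (\<tau> \<alpha>)))\<^sup>2) \<partial>M)"

definition continuous_Bessel_family ::
  "'a measure \<Rightarrow> ('h \<Rightarrow> 'h \<Rightarrow> 'k::real_or_complex) \<Rightarrow> ('a \<Rightarrow> 'h) \<Rightarrow> bool" where
  "continuous_Bessel_family M ip \<tau> \<longleftrightarrow>
     (\<forall>h. (\<lambda>\<alpha>. ip h (\<tau> \<alpha>)) \<in> borel_measurable M) \<and>
     (\<exists>b>0. \<forall>h. frame_integral M ip \<tau> h \<le> ennreal (b * (ip_norm ip h)\<^sup>2))"

definition tight_continuous_frame ::
  "'a measure \<Rightarrow> ('h \<Rightarrow> 'h \<Rightarrow> 'k::real_or_complex) \<Rightarrow> ('a \<Rightarrow> 'h) \<Rightarrow> bool" where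
  "tight_continuous_frame M ip \<tau> \<longleftrightarrow>
     (\<forall>h. (\<lambda>\<alpha>. ip h (\<tau> \<alpha>)) \<in> borel_measurable M) \<and>
     (\<exists>a>0. \<forall>h. ennreal (a * (ip_norm ip h)\<^sup>2) \<le> frame_integral M ip \<tau> h \<and>
                 frame_integral M ip \<tau> h \<le> ennreal (a * (ip_norm ip h)\<^sup>2))"

definition normalized_family ::
  "'a measure \<Rightarrow> ('h \<Rightarrow> 'h \<Rightarrow> 'k::real_or_complex) \<Rightarrow> ('a \<Rightarrow> 'h) \<Rightarrow> bool" where
  "normalized_family M ip \<tau> \<longleftrightarrow> (\<forall>\<alpha>\<in>space M. ip_norm ip (\<tau> \<alpha>) = 1)"

definition diagonal :: "'a measure \<Rightarrow> ('a \<times> 'a) set" where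
  "diagonal M = {(\<alpha>, \<alpha>) | \<alpha>. \<alpha> \<in> space M}"

end

theory Submission
  imports Defs "HOL-Combinatorics.Multiset_Permutations"
begin

text \<open>
  The \<open>m\<close>-th power of \<open>\<langle>\<tau> \<alpha>, \<tau> \<beta>\<rangle>\<close> is the inner product of the \<open>m\<close>-th tensor powers of the two
  vectors. These are unit vectors in the symmetric power, whose dimension is
  \<open>N = (d + m - 1) choose m\<close>. Let \<open>S\<close> be the positive operator on the symmetric power that integrates
  the rank-one projections onto them. Its trace is \<open>\<mu>(\<Omega>)\<close>, and the double integral of
  \<open>\<bar>\<langle>\<tau> \<alpha>, \<tau> \<beta>\<rangle>\<bar>\<close> to the power \<open>2 * m\<close> is its squared Hilbert-Schmidt norm. That norm is at least
  \<open>(trace S)\<^sup>2 / N\<close>, with equality exactly if \<open>S\<close> is a multiple of the identity. In that case, for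
  positive \<open>m\<close>, a partial trace shows that the frame operator of the family itself is a multiple of
  the identity, so that the family is a tight frame unless the measure is zero.

  The proof carries this out in coordinates. Since the family is Bessel and normalized, the measure
  is finite (\<open>sum_frame_integrals\<close>). An orthonormal basis turns the family into complex coordinate
  functions, and the multinomial theorem (\<open>multinomial_multiset\<close>) replaces tensor powers by the monomials
  in these functions, indexed by multisets of size \<open>m\<close>. The operator \<open>S\<close> becomes a Gram matrix of
  monomials (\<open>frame_potential\<close>). The difference between the two sides of the bound is an explicit
  sum of squares (\<open>potential_excess\<close>), and the partial trace is \<open>isotropic_of_minimal_potential\<close>.

  For \<open>m = 1\<close> the converse holds since the inner integral of the frame potential is the constant
  frame bound (\<open>first_frame_potential_of_tight\<close>), and for \<open>d = 1\<close> the kernel is constantly 1. In all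
  other cases with positive \<open>d\<close> and \<open>m\<close> an orthonormal basis with the counting measure is a tight frame
  without equality: the double integral is \<open>d\<close>, and \<open>d\<^sup>2 / N < d\<close>. The bound for the supremum follows by
  splitting the double integral along the diagonal (\<open>sup_welch_bound\<close>).
\<close>

section \<open>The multinomial theorem over multisets\<close>

lemma sum_power_eq_sum_words:
  fixes x :: "'i \<Rightarrow> 'c::comm_semiring_1"
  shows "(\<Sum>i\<in>A. x i) ^ n = (\<Sum>w | set w \<subseteq> A \<and> length w = n. prod_list (map x w))"
proof (induction n)
  case 0
  have "{w. set w \<subseteq> A \<and> length w = 0} = {[]}" by auto
  then show ?case by simp
next
  case (Suc n)
  let ?W = "{w. set w \<subseteq> A \<and> length w = n}"
  have inj: "inj_on (\<lambda>(w, i). i # w) (?W \<times> A)"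
    by (auto simp: inj_on_def)
  have "(\<Sum>w | set w \<subseteq> A \<and> length w = Suc n. prod_list (map x w))
      = (\<Sum>(w, i)\<in>?W \<times> A. x i * prod_list (map x w))"
    unfolding lists_length_Suc_eq
    by (subst sum.reindex[OF inj]) (simp add: case_prod_unfold comp_def)
  also have "\<dots> = (\<Sum>w\<in>?W. \<Sum>i\<in>A. x i * prod_list (map x w))"
    by (rule sum.cartesian_product[symmetric])
  also have "\<dots> = (\<Sum>i\<in>A. x i) * (\<Sum>i\<in>A. x i) ^ n"
    by (simp add: Suc.IH sum_distrib_left sum_distrib_right)
  finally show ?case by simp
qed

text \<open>
  Expanding the product gives one term per word over \<open>A\<close>, and words with the same underlying
  multiset give the same term. The multinomial coefficient is kept as the number of words over the
  multiset, which makes its positivity and its invariance under relabelling immediate.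
\<close>
theorem multinomial_multiset:
  fixes x :: "'i \<Rightarrow> 'c::comm_semiring_1"
  assumes "finite A"
  shows "(\<Sum>i\<in>A. x i) ^ n =
    (\<Sum>K\<in>multisets_of_size A n. of_nat (card (permutations_of_multiset K)) * (\<Prod>i\<in>#K. x i))"
proof -
  let ?W = "{w. set w \<subseteq> A \<and> length w = n}"
  have fibre: "{w \<in> ?W. mset w = K} = permutations_of_multiset K"
    if "K \<in> multisets_of_size A n" for K
    using that by (auto simp: multisets_of_size_def permutations_of_multiset_def)
  have "(\<Sum>i\<in>A. x i) ^ n = (\<Sum>w\<in>?W. prod_list (map x w))"
    by (rule sum_power_eq_sum_words)
  also have "\<dots> = (\<Sum>K\<in>multisets_of_size A n. \<Sum>w\<in>{w \<in> ?W. mset w = K}. prod_list (map x w))"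
    using assms
    by (intro sum.group[symmetric] finite_lists_length_eq)
       (auto simp: multisets_of_size_def intro!: finite_multisets_of_size[unfolded multisets_of_size_def])
  also have "\<dots> = (\<Sum>K\<in>multisets_of_size A n. \<Sum>w\<in>permutations_of_multiset K. \<Prod>i\<in>#K. x i)"
  proof (intro sum.cong refl)
    fix K and w :: "'i list" assume "w \<in> permutations_of_multiset K"
    then have "mset w = K" by (rule permutations_of_multisetD)
    moreover have "prod_list (map x w) = prod_mset (mset (map x w))"
      by (rule prod_mset_prod_list[symmetric])
    ultimately show "prod_list (map x w) = (\<Prod>i\<in>#K. x i)"
      by auto
  qed (use fibre in auto)
  finally show ?thesis by simp
qed

text \<open>
  The symmetry that forces the diagonal second moments of an extremal family to coincide.
\<close>
lemma card_permutations_of_multiset_image: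
  assumes "inj_on f (set_mset K)"
  shows "card (permutations_of_multiset (image_mset f K)) = card (permutations_of_multiset K)"
  unfolding permutations_of_multiset_image
proof (rule card_image)
  show "inj_on (map f) (permutations_of_multiset K)"
  proof (rule inj_onI)
    fix w w' assume "w \<in> permutations_of_multiset K" "w' \<in> permutations_of_multiset K"
      and "map f w = map f w'"
    moreover from this have "set w = set_mset K" "set w' = set_mset K"
      by (metis permutations_of_multisetD set_mset_mset)+
    ultimately show "w = w'"
      using assms by (simp add: inj_on_map_eq_map)
  qed
qed

section \<open>The frame potential in coordinates\<close>

lemma cnj_prod_mset: "cnj (\<Prod>i\<in>#K. f i) = (\<Prod>i\<in>#K. cnj (f i))"
  by (induction K) auto

text \<open>
  A family of unit vectors, given by its coordinates \<open>v i\<close> with respect to an orthonormal basis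
  indexed by \<open>I\<close>. The coordinates are complex in both the real and the complex case.
\<close>
locale unit_vector_field = finite_measure M for M :: "'a measure" +
  fixes I :: "'i set" and v :: "'i \<Rightarrow> 'a \<Rightarrow> complex"
  assumes finite_I: "finite I"
    and measurable_coordinate: "i \<in> I \<Longrightarrow> v i \<in> borel_measurable M"
    and unit: "\<alpha> \<in> space M \<Longrightarrow> (\<Sum>i\<in>I. (norm (v i \<alpha>))\<^sup>2) = 1"
begin

definition pairing :: "'a \<Rightarrow> 'a \<Rightarrow> complex" where
  "pairing \<alpha> \<beta> = (\<Sum>i\<in>I. v i \<alpha> * cnj (v i \<beta>))"

text \<open>
  Up to the factor \<open>sqrt (num_words K)\<close>, the monomials of degree \<open>m\<close> are the coordinates of the
  \<open>m\<close>-th tensor power in the symmetric power, and \<open>gram\<close> is the matrix of the frame operator of the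
  tensor powers.
\<close>
definition monomial :: "'i multiset \<Rightarrow> 'a \<Rightarrow> complex" where
  "monomial K \<alpha> = (\<Prod>i\<in>#K. v i \<alpha>)"

definition gram :: "'i multiset \<Rightarrow> 'i multiset \<Rightarrow> complex" where
  "gram K L = (\<integral>\<alpha>. monomial K \<alpha> * cnj (monomial L \<alpha>) \<partial>M)"

definition num_words :: "'i multiset \<Rightarrow> real" where
  "num_words K = real (card (permutations_of_multiset K))"

lemma num_words_pos: "num_words K > 0"
  by (simp add: num_words_def card_gt_0_iff)

lemma finite_multisets: "finite (multisets_of_size I m)"
  using finite_I by (rule finite_multisets_of_size)

lemma norm_coordinate_le_1:
  assumes "i \<in> I" "\<alpha> \<in> space M"
  shows "norm (v i \<alpha>) \<le> 1"
proof -
  have "(norm (v i \<alpha>))\<^sup>2 \<le> (\<Sum>i\<in>I. (norm (v i \<alpha>))\<^sup>2)"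
    using assms finite_I by (intro member_le_sum) auto
  with unit[OF assms(2)] show ?thesis
    by (simp add: abs_square_le_1)
qed

lemma norm_monomial_le_1:
  assumes "set_mset K \<subseteq> I" "\<alpha> \<in> space M"
  shows "norm (monomial K \<alpha>) \<le> 1"
  using assms(1)
  by (induction K)
     (auto simp: monomial_def norm_mult intro!: mult_le_one norm_coordinate_le_1 assms(2))

lemma measurable_monomial:
  assumes "set_mset K \<subseteq> I"
  shows "monomial K \<in> borel_measurable M"
  using assms
proof (induction K)
  case (add i K)
  then have "(\<lambda>\<alpha>. v i \<alpha> * monomial K \<alpha>) \<in> borel_measurable M"
    by (intro borel_measurable_times measurable_coordinate) auto
  then show ?case
    by (simp add: monomial_def[abs_def])
qed (simp add: monomial_def[abs_def])

lemma integrable_monomials: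
  assumes "set_mset K \<subseteq> I" "set_mset L \<subseteq> I"
  shows "integrable M (\<lambda>\<alpha>. monomial K \<alpha> * cnj (monomial L \<alpha>))"
proof (rule integrable_const_bound[where B = 1])
  show "AE \<alpha> in M. norm (monomial K \<alpha> * cnj (monomial L \<alpha>)) \<le> 1"
    by (auto simp: norm_mult intro!: AE_I2 mult_le_one norm_monomial_le_1 assms)
  have "(\<lambda>\<alpha>. cnj (monomial L \<alpha>)) \<in> borel_measurable M"
    by (intro borel_measurable_continuous_on[OF _ measurable_monomial] assms continuous_intros)
  then show "(\<lambda>\<alpha>. monomial K \<alpha> * cnj (monomial L \<alpha>)) \<in> borel_measurable M"
    by (intro borel_measurable_times measurable_monomial assms)
qed

lemma gram_cnj: "cnj (gram K L) = gram L K"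
  by (simp add: gram_def mult.commute flip: Bochner_Integration.integral_cnj)

lemma pairing_power:
  "pairing \<alpha> \<beta> ^ m =
    (\<Sum>K\<in>multisets_of_size I m. of_real (num_words K) * (monomial K \<alpha> * cnj (monomial K \<beta>)))"
  unfolding pairing_def multinomial_multiset[OF finite_I] monomial_def
  by (simp add: num_words_def prod_mset.distrib cnj_prod_mset)

lemma norm_pairing_power:
  "of_real (norm (pairing \<alpha> \<beta>) ^ (2 * m)) =
    (\<Sum>K\<in>multisets_of_size I m. \<Sum>L\<in>multisets_of_size I m. of_real (num_words K * num_words L) *
       (monomial K \<alpha> * cnj (monomial L \<alpha>)) * (monomial L \<beta> * cnj (monomial K \<beta>)))"
proof -
  have "of_real (norm (pairing \<alpha> \<beta>) ^ (2 * m)) = pairing \<alpha> \<beta> ^ m * cnj (pairing \<alpha> \<beta> ^ m)"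
    by (simp add: power_mult complex_norm_square[symmetric] flip: power_mult_distrib)
  also have "\<dots> = (\<Sum>K\<in>multisets_of_size I m. \<Sum>L\<in>multisets_of_size I m. of_real (num_words K * num_words L) *
       (monomial K \<alpha> * cnj (monomial L \<alpha>)) * (monomial L \<beta> * cnj (monomial K \<beta>)))"
    unfolding pairing_power cnj_sum sum_product
    by (intro sum.cong refl) (simp add: mult_ac)
  finally show ?thesis .
qed

text \<open>
  The kernel is a finite sum of products of a function of \<open>\<alpha>\<close> and a function of \<open>\<beta>\<close>, so that
  both integrations can be carried out term by term. The result is the squared Hilbert-Schmidt norm
  of the frame operator of the tensor powers.
\<close>
lemma frame_potential:
  "(\<integral>\<^sup>+\<beta>. (\<integral>\<^sup>+\<alpha>. ennreal (norm (pairing \<alpha> \<beta>) ^ (2 * m)) \<partial>M) \<partial>M) =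
    ennreal (\<Sum>K\<in>multisets_of_size I m. \<Sum>L\<in>multisets_of_size I m.
      num_words K * num_words L * (norm (gram K L))\<^sup>2)"
proof -
  let ?P = "multisets_of_size I m"
  let ?f = "\<lambda>\<alpha> \<beta>. norm (pairing \<alpha> \<beta>) ^ (2 * m)"
  have sub: "set_mset K \<subseteq> I" if "K \<in> ?P" for K
    using that by (rule multisets_of_size_subset)
  note [intro!] = integrable_monomials sub
  have int1: "integrable M (\<lambda>\<alpha>. of_real (?f \<alpha> \<beta>) :: complex)" for \<beta>
    unfolding norm_pairing_power
    by (intro Bochner_Integration.integrable_sum integrable_mult_left integrable_mult_right) auto
  have int1': "integrable M (\<lambda>\<alpha>. ?f \<alpha> \<beta>)" for \<beta>
    using integrable_Re[OF int1[of \<beta>]] by simp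
  have eq1: "of_real (\<integral>\<alpha>. ?f \<alpha> \<beta> \<partial>M) =
    (\<Sum>K\<in>?P. \<Sum>L\<in>?P. of_real (num_words K * num_words L) * gram K L * (monomial L \<beta> * cnj (monomial K \<beta>)))" for \<beta>
  proof -
    have "of_real (\<integral>\<alpha>. ?f \<alpha> \<beta> \<partial>M) = (\<integral>\<alpha>. of_real (?f \<alpha> \<beta>) \<partial>M :: complex)"
      by (rule integral_complex_of_real[symmetric])
    also have "\<dots> = (\<Sum>K\<in>?P. \<Sum>L\<in>?P. \<integral>\<alpha>. of_real (num_words K * num_words L) *
       (monomial K \<alpha> * cnj (monomial L \<alpha>)) * (monomial L \<beta> * cnj (monomial K \<beta>)) \<partial>M)"
      unfolding norm_pairing_power
      by (subst Bochner_Integration.integral_sum;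
          intro Bochner_Integration.integrable_sum integrable_mult_left integrable_mult_right
            sum.cong refl Bochner_Integration.integral_sum) auto
    finally show ?thesis
      by (simp add: gram_def)
  qed
  have int2: "integrable M (\<lambda>\<beta>. of_real (\<integral>\<alpha>. ?f \<alpha> \<beta> \<partial>M) :: complex)"
    unfolding eq1
    by (intro Bochner_Integration.integrable_sum integrable_mult_left integrable_mult_right) auto
  have int2': "integrable M (\<lambda>\<beta>. \<integral>\<alpha>. ?f \<alpha> \<beta> \<partial>M)"
    using integrable_Re[OF int2] by simp
  have "of_real (\<integral>\<beta>. (\<integral>\<alpha>. ?f \<alpha> \<beta> \<partial>M) \<partial>M) = (\<integral>\<beta>. of_real (\<integral>\<alpha>. ?f \<alpha> \<beta> \<partial>M) \<partial>M :: complex)"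
    by simp
  also have "\<dots> = (\<Sum>K\<in>?P. \<Sum>L\<in>?P. \<integral>\<beta>. of_real (num_words K * num_words L) * gram K L *
       (monomial L \<beta> * cnj (monomial K \<beta>)) \<partial>M)"
    unfolding eq1
    by (subst Bochner_Integration.integral_sum;
        intro Bochner_Integration.integrable_sum integrable_mult_left integrable_mult_right
          sum.cong refl Bochner_Integration.integral_sum) auto
  also have "\<dots> = (\<Sum>K\<in>?P. \<Sum>L\<in>?P. of_real (num_words K * num_words L) * (gram K L * gram L K))"
    by (simp add: gram_def[of L K for L K, symmetric] mult.assoc)
  also have "\<dots> = of_real (\<Sum>K\<in>?P. \<Sum>L\<in>?P. num_words K * num_words L * (norm (gram K L))\<^sup>2)"
    by (simp only: of_real_sum of_real_mult complex_norm_square gram_cnj)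
  finally have eq2: "(\<integral>\<beta>. (\<integral>\<alpha>. ?f \<alpha> \<beta> \<partial>M) \<partial>M) =
      (\<Sum>K\<in>?P. \<Sum>L\<in>?P. num_words K * num_words L * (norm (gram K L))\<^sup>2)"
    by (simp only: of_real_eq_iff)
  have "(\<integral>\<^sup>+\<beta>. (\<integral>\<^sup>+\<alpha>. ennreal (?f \<alpha> \<beta>) \<partial>M) \<partial>M) = (\<integral>\<^sup>+\<beta>. ennreal (\<integral>\<alpha>. ?f \<alpha> \<beta> \<partial>M) \<partial>M)"
    by (intro nn_integral_cong nn_integral_eq_integral int1') auto
  also have "\<dots> = ennreal (\<integral>\<beta>. (\<integral>\<alpha>. ?f \<alpha> \<beta> \<partial>M) \<partial>M)"
    by (intro nn_integral_eq_integral int2') auto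
  finally show ?thesis
    by (simp only: eq2)
qed

lemma pairing_self: "\<alpha> \<in> space M \<Longrightarrow> pairing \<alpha> \<alpha> = 1"
  using unit by (simp add: pairing_def complex_norm_square[symmetric] flip: of_real_power of_real_sum)

text \<open>
  The trace of the frame operator: tensor powers of unit vectors are unit vectors.
\<close>
lemma trace_gram:
  "(\<Sum>K\<in>multisets_of_size I m. num_words K * Re (gram K K)) = measure M (space M)"
proof -
  let ?P = "multisets_of_size I m"
  have sub: "set_mset K \<subseteq> I" if "K \<in> ?P" for K
    using that by (rule multisets_of_size_subset)
  have "(\<Sum>K\<in>?P. of_real (num_words K) * gram K K) =
      (\<integral>\<alpha>. (\<Sum>K\<in>?P. of_real (num_words K) * (monomial K \<alpha> * cnj (monomial K \<alpha>))) \<partial>M)"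
    by (subst Bochner_Integration.integral_sum)
       (auto simp: gram_def intro!: integrable_mult_right integrable_monomials sub)
  also have "\<dots> = (\<integral>\<alpha>. pairing \<alpha> \<alpha> ^ m \<partial>M)"
    by (simp add: pairing_power)
  also have "\<dots> = (\<integral>\<alpha>. 1 \<partial>M)"
    by (intro Bochner_Integration.integral_cong refl) (simp add: pairing_self)
  finally have "Re (\<Sum>K\<in>?P. of_real (num_words K) * gram K K) = measure M (space M)"
    by simp
  then show ?thesis by simp
qed

lemma gram_diagonal: "gram K K = of_real (Re (gram K K))"
  using gram_cnj[of K K] by (simp add: complex_eq_iff)

section \<open>The Welch bound and its equality case\<close>

text \<open>
  Among positive operators with trace \<open>c\<close> on a space of dimension \<open>N\<close>, the multiple \<open>c / N\<close> of the
  identity has the smallest Hilbert-Schmidt norm. Stating this as an identity with an explicit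
  nonnegative excess, rather than as the Cauchy-Schwarz inequality, yields the bound and its
  equality case at once.
\<close>
lemma potential_excess:
  assumes "card (multisets_of_size I m) \<noteq> 0"
  defines "N \<equiv> real (card (multisets_of_size I m))"
    and "c \<equiv> measure M (space M)"
  shows "(\<Sum>K\<in>multisets_of_size I m. \<Sum>L\<in>multisets_of_size I m.
        num_words K * num_words L * (norm (gram K L))\<^sup>2) =
      c\<^sup>2 / N
      + (\<Sum>K\<in>multisets_of_size I m. (num_words K * Re (gram K K) - c / N)\<^sup>2)
      + (\<Sum>K\<in>multisets_of_size I m. \<Sum>L\<in>multisets_of_size I m - {K}.
          num_words K * num_words L * (norm (gram K L))\<^sup>2)"
proof -
  let ?P = "multisets_of_size I m"
  let ?a = "\<lambda>K. num_words K * Re (gram K K)"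
  have N: "N \<noteq> 0" using assms(1) by (simp add: N_def)
  have diag: "(norm (gram K K))\<^sup>2 = (Re (gram K K))\<^sup>2" for K
    by (subst gram_diagonal) (simp only: norm_of_real power2_abs)
  have "(\<Sum>K\<in>?P. \<Sum>L\<in>?P. num_words K * num_words L * (norm (gram K L))\<^sup>2) =
      (\<Sum>K\<in>?P. (?a K)\<^sup>2 + (\<Sum>L\<in>?P - {K}. num_words K * num_words L * (norm (gram K L))\<^sup>2))"
  proof (intro sum.cong refl)
    fix K assume "K \<in> ?P"
    then show "(\<Sum>L\<in>?P. num_words K * num_words L * (norm (gram K L))\<^sup>2) =
        (?a K)\<^sup>2 + (\<Sum>L\<in>?P - {K}. num_words K * num_words L * (norm (gram K L))\<^sup>2)"
      by (simp add: sum.remove[OF finite_multisets] diag power_mult_distrib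
          power2_eq_square[of "num_words K"])
  qed
  moreover have "(\<Sum>K\<in>?P. (?a K - c / N)\<^sup>2) = (\<Sum>K\<in>?P. (?a K)\<^sup>2) - c\<^sup>2 / N"
  proof -
    have "(\<Sum>K\<in>?P. (?a K - c / N)\<^sup>2) = (\<Sum>K\<in>?P. (?a K)\<^sup>2 - 2 * (c / N) * ?a K + (c / N)\<^sup>2)"
      by (intro sum.cong refl) (simp add: power2_diff)
    also have "\<dots> = (\<Sum>K\<in>?P. (?a K)\<^sup>2) - 2 * (c / N) * (\<Sum>K\<in>?P. ?a K) + N * (c / N)\<^sup>2"
      by (simp add: sum.distrib sum_subtractf sum_distrib_left N_def)
    also have "\<dots> = (\<Sum>K\<in>?P. (?a K)\<^sup>2) - c\<^sup>2 / N"
      unfolding trace_gram c_def[symmetric] using N by (simp add: field_simps power2_eq_square)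
    finally show ?thesis .
  qed
  ultimately show ?thesis
    by (simp add: sum.distrib)
qed

lemma potential_ge:
  assumes "card (multisets_of_size I m) \<noteq> 0"
  shows "(measure M (space M))\<^sup>2 / real (card (multisets_of_size I m)) \<le>
    (\<Sum>K\<in>multisets_of_size I m. \<Sum>L\<in>multisets_of_size I m.
        num_words K * num_words L * (norm (gram K L))\<^sup>2)"
proof -
  have "0 \<le> (\<Sum>K\<in>multisets_of_size I m. \<Sum>L\<in>multisets_of_size I m - {K}.
          num_words K * num_words L * (norm (gram K L))\<^sup>2)"
    by (intro sum_nonneg mult_nonneg_nonneg zero_le_power2 less_imp_le[OF num_words_pos])
  then show ?thesis
    unfolding potential_excess[OF assms]
    by (smt (verit) sum_nonneg zero_le_power2)
qed

lemma gram_of_minimal_potential: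
  assumes "card (multisets_of_size I m) \<noteq> 0"
    and "(\<Sum>K\<in>multisets_of_size I m. \<Sum>L\<in>multisets_of_size I m.
        num_words K * num_words L * (norm (gram K L))\<^sup>2)
      = (measure M (space M))\<^sup>2 / real (card (multisets_of_size I m))"
    and K: "K \<in> multisets_of_size I m" and L: "L \<in> multisets_of_size I m"
  shows "gram K L = (if K = L
      then of_real (measure M (space M) / real (card (multisets_of_size I m)) / num_words K) else 0)"
proof -
  let ?P = "multisets_of_size I m"
  let ?b = "measure M (space M) / real (card ?P)"
  let ?D = "\<Sum>K\<in>?P. (num_words K * Re (gram K K) - ?b)\<^sup>2"
  let ?O = "\<Sum>K\<in>?P. \<Sum>L\<in>?P - {K}. num_words K * num_words L * (norm (gram K L))\<^sup>2"
  have nonneg: "0 \<le> num_words K * num_words L * (norm (gram K L))\<^sup>2" for K L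
    using num_words_pos[of K] num_words_pos[of L] by (simp add: less_imp_le)
  have "?D + ?O = 0"
    using assms(2) unfolding potential_excess[OF assms(1)] by simp
  moreover have "?D \<ge> 0" "?O \<ge> 0"
    by (auto intro!: sum_nonneg nonneg)
  ultimately have D: "?D = 0" and O: "?O = 0"
    by linarith+
  show ?thesis
  proof (cases "K = L")
    case True
    have "(num_words K * Re (gram K K) - ?b)\<^sup>2 = 0"
      using D K by (subst (asm) sum_nonneg_eq_0_iff) (auto simp: finite_multisets)
    then have "num_words K * Re (gram K K) = ?b"
      by simp
    then have "Re (gram K K) = ?b / num_words K"
      using num_words_pos[of K] by (metis less_irrefl nonzero_mult_div_cancel_left)
    with True gram_diagonal[of K] show ?thesis by simp
  next
    case False
    have "(\<Sum>L\<in>?P - {K}. num_words K * num_words L * (norm (gram K L))\<^sup>2) = 0"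
      using O K
      by (subst (asm) sum_nonneg_eq_0_iff) (auto simp: finite_multisets intro!: sum_nonneg nonneg)
    then have "num_words K * num_words L * (norm (gram K L))\<^sup>2 = 0"
      using L False
      by (subst (asm) sum_nonneg_eq_0_iff) (auto simp: finite_multisets intro!: nonneg)
    then show ?thesis
      using num_words_pos[of K] num_words_pos[of L] False by simp
  qed
qed

lemma integrable_coordinates:
  assumes "i \<in> I" "j \<in> I"
  shows "integrable M (\<lambda>\<alpha>. v i \<alpha> * cnj (v j \<alpha>))"
  using integrable_monomials[of "{#i#}" "{#j#}"] assms by (simp add: monomial_def)

text \<open>
  Multiplying the integrand by the constant \<open>pairing \<alpha> \<alpha> ^ p = 1\<close> raises the degree of the
  monomials to \<open>p + 1\<close>. This is the partial trace that recovers the frame operator of the family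
  from the one of its tensor powers.
\<close>
lemma second_moment_eq_sum_gram:
  assumes "i \<in> I" "j \<in> I"
  shows "(\<integral>\<alpha>. v i \<alpha> * cnj (v j \<alpha>) \<partial>M) =
    (\<Sum>U\<in>multisets_of_size I p. of_real (num_words U) * gram (add_mset i U) (add_mset j U))"
proof -
  let ?Q = "multisets_of_size I p"
  have "(\<integral>\<alpha>. v i \<alpha> * cnj (v j \<alpha>) \<partial>M) = (\<integral>\<alpha>. v i \<alpha> * cnj (v j \<alpha>) * pairing \<alpha> \<alpha> ^ p \<partial>M)"
    by (intro Bochner_Integration.integral_cong refl) (simp add: pairing_self)
  also have "\<dots> = (\<integral>\<alpha>. (\<Sum>U\<in>?Q. of_real (num_words U) *
      (monomial (add_mset i U) \<alpha> * cnj (monomial (add_mset j U) \<alpha>))) \<partial>M)"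
    unfolding pairing_power sum_distrib_left
    by (intro Bochner_Integration.integral_cong sum.cong refl) (simp add: monomial_def mult_ac)
  also have "\<dots> = (\<Sum>U\<in>?Q. of_real (num_words U) * gram (add_mset i U) (add_mset j U))"
    by (subst Bochner_Integration.integral_sum)
       (use assms in \<open>auto simp: gram_def multisets_of_size_def
          intro!: integrable_mult_right integrable_monomials\<close>)
  finally show ?thesis .
qed

lemma trace_second_moment:
  "(\<Sum>i\<in>I. \<integral>\<alpha>. v i \<alpha> * cnj (v i \<alpha>) \<partial>M) = of_real (measure M (space M))"
proof -
  have "(\<Sum>i\<in>I. \<integral>\<alpha>. v i \<alpha> * cnj (v i \<alpha>) \<partial>M) = (\<integral>\<alpha>. pairing \<alpha> \<alpha> \<partial>M)"
    unfolding pairing_def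
    by (rule Bochner_Integration.integral_sum[symmetric]) (rule integrable_coordinates)
  also have "\<dots> = (\<integral>\<alpha>. 1 \<partial>M)"
    by (intro Bochner_Integration.integral_cong refl pairing_self)
  finally show ?thesis by (simp add: scaleR_conv_of_real)
qed

text \<open>
  If the frame operator of the tensor powers is a multiple of the identity, so is the frame operator
  of the family itself. Off-diagonal second moments vanish because adding different elements to a
  multiset gives different multisets. The diagonal ones agree because exchanging two coordinates
  permutes the multisets and preserves the number of words; their common value is then
  determined by the trace.
\<close>
lemma isotropic_of_minimal_potential:
  assumes "m \<ge> 1" and "card (multisets_of_size I m) \<noteq> 0"
    and "(\<Sum>K\<in>multisets_of_size I m. \<Sum>L\<in>multisets_of_size I m.
        num_words K * num_words L * (norm (gram K L))\<^sup>2)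
      = (measure M (space M))\<^sup>2 / real (card (multisets_of_size I m))"
    and i: "i \<in> I" and j: "j \<in> I"
  shows "(\<integral>\<alpha>. v i \<alpha> * cnj (v j \<alpha>) \<partial>M) =
    (if i = j then of_real (measure M (space M) / real (card I)) else 0)"
proof -
  from assms(1) obtain p where m: "m = Suc p"
    by (cases m) auto
  let ?Q = "multisets_of_size I p"
  let ?b = "measure M (space M) / real (card (multisets_of_size I m))"
  have mem: "add_mset k U \<in> multisets_of_size I m" if "k \<in> I" "U \<in> ?Q" for k U
    using that by (auto simp: multisets_of_size_def m)
  have gram: "gram (add_mset k U) (add_mset l U) =
      (if k = l then of_real (?b / num_words (add_mset k U)) else 0)"
    if "k \<in> I" "l \<in> I" "U \<in> ?Q" for k l U
    using gram_of_minimal_potential[OF assms(2,3) mem[OF that(1,3)] mem[OF that(2,3)]] by simp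
  define c where "c k = (\<Sum>U\<in>?Q. num_words U * (?b / num_words (add_mset k U)))" for k
  have moment: "(\<integral>\<alpha>. v k \<alpha> * cnj (v l \<alpha>) \<partial>M) = (if k = l then of_real (c k) else 0)"
    if "k \<in> I" "l \<in> I" for k l
    unfolding second_moment_eq_sum_gram[OF that, of p] c_def
    using gram[OF that] by simp
  have c_eq: "c k = c l" if "k \<in> I" "l \<in> I" for k l
  proof -
    let ?t = "image_mset (Transposition.transpose k l)"
    have words_image: "num_words (?t U) = num_words U" for U
      unfolding num_words_def by (simp add: card_permutations_of_multiset_image)
    have add: "add_mset l (?t U) = ?t (add_mset k U)" "add_mset k (?t U) = ?t (add_mset l U)" for U
      by simp_all
    have Q: "?t U \<in> ?Q" if U: "U \<in> ?Q" for U
      using U \<open>k \<in> I\<close> \<open>l \<in> I\<close>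
      by (auto simp: multisets_of_size_def Transposition.transpose_def)
    show ?thesis
      unfolding c_def
      by (rule sum.reindex_bij_witness[where i = ?t and j = ?t])
         (simp_all only: add words_image Q, simp_all add: multiset.map_comp)
  qed
  have "of_real (\<Sum>k\<in>I. c k) = (of_real (measure M (space M)) :: complex)"
    unfolding trace_second_moment[symmetric] of_real_sum
    by (intro sum.cong refl) (simp add: moment)
  then have "(\<Sum>k\<in>I. c k) = measure M (space M)"
    by (simp only: of_real_eq_iff)
  moreover have "(\<Sum>k\<in>I. c k) = (\<Sum>k\<in>I. c i)"
    by (intro sum.cong refl c_eq i)
  ultimately have "real (card I) * c i = measure M (space M)"
    by simp
  moreover have "card I \<noteq> 0"
    using i finite_I by auto
  ultimately have c: "c i = measure M (space M) / real (card I)"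
    by (metis nonzero_mult_div_cancel_left of_nat_eq_0_iff)
  show ?thesis
    unfolding moment[OF i j] c by (rule refl)
qed

text \<open>
  A frame operator that is a multiple of the identity, read as a frame identity for the vector with
  coordinates \<open>x\<close>.
\<close>
lemma nn_integral_linear_form:
  assumes "\<And>i j. i \<in> I \<Longrightarrow> j \<in> I \<Longrightarrow>
      (\<integral>\<alpha>. v i \<alpha> * cnj (v j \<alpha>) \<partial>M) = (if i = j then of_real c else 0)"
  shows "(\<integral>\<^sup>+\<alpha>. ennreal ((norm (\<Sum>i\<in>I. x i * cnj (v i \<alpha>)))\<^sup>2) \<partial>M) =
    ennreal (c * (\<Sum>i\<in>I. (norm (x i))\<^sup>2))"
proof -
  let ?f = "\<lambda>\<alpha>. (norm (\<Sum>i\<in>I. x i * cnj (v i \<alpha>)))\<^sup>2"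
  have f: "of_real (?f \<alpha>) =
      (\<Sum>i\<in>I. \<Sum>j\<in>I. x i * cnj (x j) * (v j \<alpha> * cnj (v i \<alpha>)))" for \<alpha>
    unfolding complex_norm_square cnj_sum sum_product
    by (intro sum.cong refl) (simp add: mult_ac)
  have "integrable M (\<lambda>\<alpha>. of_real (?f \<alpha>) :: complex)"
    unfolding f
    by (intro Bochner_Integration.integrable_sum integrable_mult_right integrable_coordinates)
  then have int: "integrable M ?f"
    by (drule_tac integrable_Re) simp
  have "of_real (\<integral>\<alpha>. ?f \<alpha> \<partial>M) = (\<integral>\<alpha>. of_real (?f \<alpha>) \<partial>M :: complex)"
    by (rule integral_complex_of_real[symmetric])
  also have "\<dots> = (\<Sum>i\<in>I. \<Sum>j\<in>I. \<integral>\<alpha>. x i * cnj (x j) * (v j \<alpha> * cnj (v i \<alpha>)) \<partial>M)"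
    unfolding f
    by (subst Bochner_Integration.integral_sum;
        intro Bochner_Integration.integrable_sum integrable_mult_right integrable_coordinates
          sum.cong refl Bochner_Integration.integral_sum)
  also have "\<dots> = (\<Sum>i\<in>I. \<Sum>j\<in>I. if i = j then of_real c * (x i * cnj (x i)) else 0)"
    by (intro sum.cong refl) (simp add: assms)
  also have "\<dots> = of_real (c * (\<Sum>i\<in>I. (norm (x i))\<^sup>2))"
    using finite_I
    by (simp add: sum_distrib_left complex_norm_square[symmetric] flip: of_real_power)
  finally have "(\<integral>\<alpha>. ?f \<alpha> \<partial>M) = c * (\<Sum>i\<in>I. (norm (x i))\<^sup>2)"
    by (simp only: of_real_eq_iff)
  moreover have "(\<integral>\<^sup>+\<alpha>. ennreal (?f \<alpha>) \<partial>M) = ennreal (\<integral>\<alpha>. ?f \<alpha> \<partial>M)"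
    by (intro nn_integral_eq_integral int) auto
  ultimately show ?thesis by simp
qed

lemma norm_pairing_le_1:
  assumes "\<alpha> \<in> space M" "\<beta> \<in> space M"
  shows "norm (pairing \<alpha> \<beta>) \<le> 1"
proof -
  have "norm (pairing \<alpha> \<beta>) \<le> (\<Sum>i\<in>I. norm (v i \<alpha>) * norm (v i \<beta>))"
    unfolding pairing_def by (rule order_trans[OF norm_sum]) (simp add: norm_mult)
  also have "\<dots> \<le> (\<Sum>i\<in>I. ((norm (v i \<alpha>))\<^sup>2 + (norm (v i \<beta>))\<^sup>2) / 2)"
  proof (rule sum_mono)
    fix i
    show "norm (v i \<alpha>) * norm (v i \<beta>) \<le> ((norm (v i \<alpha>))\<^sup>2 + (norm (v i \<beta>))\<^sup>2) / 2"
      using sum_squares_bound[of "norm (v i \<alpha>)" "norm (v i \<beta>)"] by simp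
  qed
  also have "\<dots> = 1"
    unfolding sum_divide_distrib[symmetric] sum.distrib using unit assms by simp
  finally show ?thesis .
qed

lemma measurable_pairing:
  "(\<lambda>(\<alpha>, \<beta>). norm (pairing \<alpha> \<beta>) ^ k) \<in> borel_measurable (M \<Otimes>\<^sub>M M)"
proof -
  have "(\<lambda>p. v i (fst p) * cnj (v i (snd p))) \<in> borel_measurable (M \<Otimes>\<^sub>M M)" if "i \<in> I" for i
  proof (rule borel_measurable_times)
    show "(\<lambda>p. v i (fst p)) \<in> borel_measurable (M \<Otimes>\<^sub>M M)"
      using measurable_fst measurable_coordinate[OF that] by (rule measurable_compose)
    have "continuous_on UNIV cnj"
      by (intro continuous_intros)
    moreover have "(\<lambda>p. v i (snd p)) \<in> borel_measurable (M \<Otimes>\<^sub>M M)"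
      using measurable_snd measurable_coordinate[OF that] by (rule measurable_compose)
    ultimately show "(\<lambda>p. cnj (v i (snd p))) \<in> borel_measurable (M \<Otimes>\<^sub>M M)"
      by (rule borel_measurable_continuous_on)
  qed
  then show ?thesis
    unfolding pairing_def case_prod_unfold
    by (intro borel_measurable_power measurable_compose[OF _ borel_measurable_norm]
        borel_measurable_sum)
qed

lemma iterated_integral_eq:
  "(\<integral>\<^sup>+\<beta>. (\<integral>\<^sup>+\<alpha>. ennreal (norm (pairing \<alpha> \<beta>) ^ k) \<partial>M) \<partial>M) =
    (\<integral>\<^sup>+(\<alpha>, \<beta>). ennreal (norm (pairing \<alpha> \<beta>) ^ k) \<partial>(M \<Otimes>\<^sub>M M))"
proof -
  interpret pair_sigma_finite M M ..
  let ?f = "\<lambda>(\<alpha>, \<beta>). ennreal (norm (pairing \<alpha> \<beta>) ^ k)"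
  have "?f \<in> borel_measurable (M \<Otimes>\<^sub>M M)"
    using measurable_pairing[of k] by (simp add: case_prod_unfold)
  from nn_integral_snd[OF this] show ?thesis by simp
qed

text \<open>
  The dimension of the \<open>m\<close>-th symmetric power.
\<close>
definition dim_sym :: "nat \<Rightarrow> nat" where
  "dim_sym m = (card I + m - 1) choose m"

lemma card_multisets: "card (multisets_of_size I m) = dim_sym m"
  unfolding dim_sym_def using finite_I by (rule card_multisets_of_size)

lemma dim_sym_pos: "I \<noteq> {} \<Longrightarrow> dim_sym m > 0"
  unfolding dim_sym_def using finite_I card_gt_0_iff[of I] by simp

lemma ennreal_welch_bound:
  assumes "dim_sym m > 0"
  shows "(emeasure M (space M))\<^sup>2 / of_nat (dim_sym m) =
    ennreal ((measure M (space M))\<^sup>2 / real (dim_sym m))"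
  using assms
  by (simp add: emeasure_eq_measure ennreal_power divide_ennreal ennreal_of_nat_eq_real_of_nat)

theorem welch_bound:
  assumes "I \<noteq> {}"
  shows "(emeasure M (space M))\<^sup>2 / of_nat (dim_sym m) \<le>
    (\<integral>\<^sup>+\<beta>. (\<integral>\<^sup>+\<alpha>. ennreal (norm (pairing \<alpha> \<beta>) ^ (2 * m)) \<partial>M) \<partial>M)"
  unfolding ennreal_welch_bound[OF dim_sym_pos[OF assms]] frame_potential
  using potential_ge[of m] dim_sym_pos[OF assms, of m]
  by (intro ennreal_leI) (simp add: card_multisets)

theorem isotropic_of_welch_equality:
  assumes "I \<noteq> {}" "m \<ge> 1"
    and "(\<integral>\<^sup>+\<beta>. (\<integral>\<^sup>+\<alpha>. ennreal (norm (pairing \<alpha> \<beta>) ^ (2 * m)) \<partial>M) \<partial>M) =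
      (emeasure M (space M))\<^sup>2 / of_nat (dim_sym m)"
    and "i \<in> I" "j \<in> I"
  shows "(\<integral>\<alpha>. v i \<alpha> * cnj (v j \<alpha>) \<partial>M) =
    (if i = j then of_real (measure M (space M) / real (card I)) else 0)"
proof (rule isotropic_of_minimal_potential[OF assms(2) _ _ assms(4,5)])
  show "card (multisets_of_size I m) \<noteq> 0"
    using dim_sym_pos[OF assms(1), of m] by (simp add: card_multisets)
  show "(\<Sum>K\<in>multisets_of_size I m. \<Sum>L\<in>multisets_of_size I m.
        num_words K * num_words L * (norm (gram K L))\<^sup>2)
      = (measure M (space M))\<^sup>2 / real (card (multisets_of_size I m))"
    using assms(3)
    unfolding ennreal_welch_bound[OF dim_sym_pos[OF assms(1)]] frame_potential card_multisets
    by (subst (asm) ennreal_inj)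
       (auto intro!: sum_nonneg mult_nonneg_nonneg less_imp_le[OF num_words_pos])
qed

section \<open>The supremum bound\<close>

text \<open>
  On the diagonal the kernel is \<open>1\<close>, elsewhere it is at most its supremum, so that the frame
  potential is at most the measure of the diagonal plus the supremum times the measure of the
  complement.
\<close>
theorem sup_welch_bound:
  assumes "I \<noteq> {}" and "diagonal M \<in> sets (M \<Otimes>\<^sub>M M)"
    and nz: "measure (M \<Otimes>\<^sub>M M) (space M \<times> space M - diagonal M) \<noteq> 0"
  shows "1 / measure (M \<Otimes>\<^sub>M M) (space M \<times> space M - diagonal M)
      * ((measure M (space M))\<^sup>2 / real (dim_sym m) - measure (M \<Otimes>\<^sub>M M) (diagonal M))
    \<le> (SUP (\<alpha>, \<beta>)\<in>space M \<times> space M - diagonal M. norm (pairing \<alpha> \<beta>) ^ (2 * m))"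
proof -
  interpret P: pair_sigma_finite M M ..
  interpret P: finite_measure "M \<Otimes>\<^sub>M M"
    by (rule finite_measure_pair_measure) unfold_locales
  let ?D = "diagonal M" and ?O = "space M \<times> space M - diagonal M"
  let ?f = "\<lambda>(\<alpha>, \<beta>). norm (pairing \<alpha> \<beta>) ^ (2 * m)"
  let ?S = "SUP p\<in>?O. ?f p"
  have f_le_1: "?f p \<le> 1" and f_ge_0: "0 \<le> ?f p" if "p \<in> space M \<times> space M" for p
    using that norm_pairing_le_1 by (auto intro!: power_le_one)
  have bdd: "bdd_above (?f ` ?O)"
    using f_le_1 by (intro bdd_aboveI2[where M = 1]) auto
  have O: "?O \<in> sets (M \<Otimes>\<^sub>M M)"
    using assms(2) by (intro sets.Diff) auto
  have "?O \<noteq> {}"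
  proof
    assume "?O = {}"
    with nz show False by (simp only: measure_empty)
  qed
  then obtain p where p: "p \<in> ?O"
    by blast
  have "0 \<le> ?f p"
    using p by (intro f_ge_0) blast
  also have "\<dots> \<le> ?S"
    by (rule cSUP_upper[OF p bdd])
  finally have S: "?S \<ge> 0" .
  have "(\<integral>\<^sup>+p. ennreal (?f p) \<partial>(M \<Otimes>\<^sub>M M)) \<le>
      (\<integral>\<^sup>+p. indicator ?D p + ennreal ?S * indicator ?O p \<partial>(M \<Otimes>\<^sub>M M))"
  proof (rule nn_integral_mono)
    fix p assume "p \<in> space (M \<Otimes>\<^sub>M M)"
    then have p: "p \<in> space M \<times> space M"
      by (simp add: space_pair_measure)
    show "ennreal (?f p) \<le> indicator ?D p + ennreal ?S * indicator ?O p"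
    proof (cases "p \<in> ?D")
      case True
      then show ?thesis
        using ennreal_leI[OF f_le_1[OF p]] by simp
    next
      case False
      then show ?thesis
        using ennreal_leI[OF cSUP_upper[OF _ bdd, of p]] p by simp
    qed
  qed
  also have "\<dots> = emeasure (M \<Otimes>\<^sub>M M) ?D + ennreal ?S * emeasure (M \<Otimes>\<^sub>M M) ?O"
    using assms(2) O by (simp add: nn_integral_add nn_integral_cmult)
  also have "\<dots> = ennreal (measure (M \<Otimes>\<^sub>M M) ?D + ?S * measure (M \<Otimes>\<^sub>M M) ?O)"
    using S by (simp add: P.emeasure_eq_measure ennreal_mult ennreal_plus)
  finally have "ennreal ((measure M (space M))\<^sup>2 / real (dim_sym m)) \<le>
      ennreal (measure (M \<Otimes>\<^sub>M M) ?D + ?S * measure (M \<Otimes>\<^sub>M M) ?O)"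
    using welch_bound[OF assms(1), of m]
    unfolding iterated_integral_eq ennreal_welch_bound[OF dim_sym_pos[OF assms(1)]]
    by (simp add: case_prod_unfold)
  then have "(measure M (space M))\<^sup>2 / real (dim_sym m) \<le>
      measure (M \<Otimes>\<^sub>M M) ?D + ?S * measure (M \<Otimes>\<^sub>M M) ?O"
    using S by (subst (asm) ennreal_le_iff) auto
  moreover have "measure (M \<Otimes>\<^sub>M M) ?O > 0"
    using nz by (simp add: zero_less_measure_iff)
  ultimately have "((measure M (space M))\<^sup>2 / real (dim_sym m) - measure (M \<Otimes>\<^sub>M M) ?D)
      / measure (M \<Otimes>\<^sub>M M) ?O \<le> ?S"
    by (simp only: pos_divide_le_eq diff_le_eq add.commute)
  then show ?thesis
    by (simp only: times_divide_eq_left mult_1)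
qed

end

section \<open>Scalars and orthonormal bases\<close>

lemma to_complex_0 [simp]: "to_complex 0 = 0"
  using norm_to_complex[of 0] by simp

lemma to_complex_1 [simp]: "to_complex (1::'k::real_or_complex) = 1"
proof -
  have "to_complex (1::'k) * to_complex (1::'k) = to_complex (1::'k)"
    using to_complex_mult[of "1::'k" 1] by simp
  moreover have "to_complex (1::'k) \<noteq> 0"
    using norm_to_complex[of "1::'k"] by auto
  ultimately show ?thesis by simp
qed

lemma to_complex_of_real: "to_complex (of_real r) = of_real r"
  by (simp add: of_real_def to_complex_scaleR)

lemma to_complex_sum: "to_complex (sum f A) = (\<Sum>a\<in>A. to_complex (f a))"
  by (induction A rule: infinite_finite_induct) (auto simp: to_complex_add)

lemma dist_to_complex: "dist (to_complex x) (to_complex y) = dist x y"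
proof -
  have "to_complex x - to_complex y = to_complex (x - y)"
    using to_complex_add[of "x - y" y] by simp
  then show ?thesis
    by (simp add: dist_norm norm_to_complex)
qed

lemma to_complex_eq_iff: "to_complex x = to_complex y \<longleftrightarrow> x = y"
  using dist_to_complex[of x y] by auto

lemma continuous_on_to_complex: "continuous_on A to_complex"
  unfolding continuous_on_iff dist_to_complex by blast

context finite_dim_hilbert_space
begin

definition orthonormal :: "'h set \<Rightarrow> bool" where
  "orthonormal B \<longleftrightarrow> (\<forall>x\<in>B. \<forall>y\<in>B. ip x y = (if x = y then 1 else 0))"

definition orthonormal_basis :: "'h set \<Rightarrow> bool" where
  "orthonormal_basis B \<longleftrightarrow>
    finite B \<and> orthonormal B \<and> (\<forall>x. (\<Sum>b\<in>B. scale (ip x b) b) = x)"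

lemma ip_0_left [simp]: "ip 0 x = 0"
  using ip_add_left[of 0 0 x] by simp

lemma ip_diff_left: "ip (x - y) z = ip x z - ip y z"
  using ip_add_left[of "x - y" y z] by simp

lemma ip_sum_left: "ip (\<Sum>b\<in>B. scale (f b) b) y = (\<Sum>b\<in>B. f b * ip b y)"
  by (induction B rule: infinite_finite_induct) (auto simp: ip_add_left ip_scale_left)

lemma norm_ip_commute: "norm (ip x y) = norm (ip y x)"
  using norm_to_complex[of "ip x y"] norm_to_complex[of "ip y x"] by (simp add: ip_conj_sym[of x y])

lemma ip_eq_0_commute: "ip x y = 0 \<Longrightarrow> ip y x = 0"
  using norm_ip_commute[of x y] by simp

lemma ip_norm_pos: "x \<noteq> 0 \<Longrightarrow> ip_norm ip x > 0"
  using ip_pos by (simp add: ip_norm_def)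

lemma to_complex_ip_self: "to_complex (ip x x) = of_real ((ip_norm ip x)\<^sup>2)"
proof -
  have "Im (to_complex (ip x x)) = 0"
    using ip_conj_sym[of x x] by (simp add: complex_eq_iff)
  moreover have "0 \<le> Re (to_complex (ip x x))"
    using ip_pos[of x] by (cases "x = 0") auto
  ultimately show ?thesis
    by (simp add: ip_norm_def complex_eq_iff)
qed

lemma orthonormal_independent:
  assumes "orthonormal B"
  shows "independent B"
  unfolding independent_explicit_finite_subsets
proof (intro allI impI ballI)
  fix S u w
  assume S: "S \<subseteq> B" "finite S" and 0: "(\<Sum>b\<in>S. scale (u b) b) = 0" and w: "w \<in> S"
  have "0 = (\<Sum>b\<in>S. u b * ip b w)"
    using 0 ip_sum_left[of u S w] by simp
  also have "\<dots> = (\<Sum>b\<in>S. if b = w then u b else 0)"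
    using assms S w by (intro sum.cong refl) (auto simp: orthonormal_def subset_iff)
  also have "\<dots> = u w"
    using S w by simp
  finally show "u w = 0" by simp
qed

text \<open>
  One Gram-Schmidt step: a vector that differs from its projection leaves a nonzero residue
  orthogonal to \<open>B\<close>, which is then normalised.
\<close>
lemma orthonormal_extend:
  assumes "finite B" "orthonormal B" and x: "(\<Sum>b\<in>B. scale (ip x b) b) \<noteq> x"
  obtains e where "e \<notin> B" "orthonormal (insert e B)"
proof -
  define r where "r = x - (\<Sum>b\<in>B. scale (ip x b) b)"
  define s where "s = 1 / ip_norm ip r"
  define e where "e = scale (of_real s) r"
  have "r \<noteq> 0" using x by (simp add: r_def)
  then have n: "ip_norm ip r > 0" by (rule ip_norm_pos)
  have r: "ip r c = 0" if "c \<in> B" for c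
  proof -
    have "ip r c = ip x c - (\<Sum>b\<in>B. ip x b * ip b c)"
      by (simp add: r_def ip_diff_left ip_sum_left)
    also have "(\<Sum>b\<in>B. ip x b * ip b c) = (\<Sum>b\<in>B. if b = c then ip x b else 0)"
      using assms(2) that by (intro sum.cong refl) (auto simp: orthonormal_def)
    finally show ?thesis
      using assms(1) that by simp
  qed
  have e: "ip e c = 0" if "c \<in> B" for c
    using r[OF that] by (simp add: e_def ip_scale_left)
  have "to_complex (ip e e) = of_real s * to_complex (ip r e)"
    by (simp add: e_def ip_scale_left to_complex_mult to_complex_of_real)
  also have "to_complex (ip r e) = of_real s * of_real ((ip_norm ip r)\<^sup>2)"
    by (subst ip_conj_sym)
       (simp add: e_def ip_scale_left to_complex_mult to_complex_of_real to_complex_ip_self)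
  finally have "to_complex (ip e e) = to_complex (1::'k)"
    using n by (simp add: s_def power2_eq_square)
  then have ee: "ip e e = 1"
    by (simp only: to_complex_eq_iff)
  show ?thesis
  proof (rule that)
    show "e \<notin> B"
      using e[of e] ee by auto
    then show "orthonormal (insert e B)"
      using assms(2) ee e ip_eq_0_commute[OF e] by (auto simp: orthonormal_def)
  qed
qed

text \<open>
  An orthonormal set of maximal cardinality is a basis. The maximum exists because orthonormal sets
  are independent and the space has a finite spanning set.
\<close>
lemma orthonormal_basis_exists: "\<exists>B. orthonormal_basis B"
proof -
  obtain S where S: "finite S" "span S = UNIV"
    using finite_dim by blast
  have bound: "finite B \<and> card B \<le> card S" if "orthonormal B" for B
    using independent_span_bound[OF S(1) orthonormal_independent[OF that]] S(2) by simp
  have "orthonormal {}" by (simp add: orthonormal_def)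
  then obtain B where B: "orthonormal B" and max: "\<And>C. orthonormal C \<Longrightarrow> card C \<le> card B"
    using ex_has_greatest_nat[of orthonormal "{}" card "Suc (card S)"] bound le_imp_less_Suc
    by metis
  have fin: "finite B" using bound[OF B] by simp
  have "(\<Sum>b\<in>B. scale (ip x b) b) = x" for x
  proof (rule ccontr)
    assume "(\<Sum>b\<in>B. scale (ip x b) b) \<noteq> x"
    from orthonormal_extend[OF fin B this] obtain e
      where "e \<notin> B" "orthonormal (insert e B)" .
    with max[of "insert e B"] fin show False by simp
  qed
  with fin B show ?thesis
    by (auto simp: orthonormal_basis_def)
qed

lemma card_orthonormal_basis:
  assumes "orthonormal_basis B"
  shows "card B = dim UNIV"
proof -
  have "x \<in> span B" for x
  proof -
    have "(\<Sum>b\<in>B. scale (ip x b) b) \<in> span B"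
      by (intro span_sum span_scale span_base)
    then show ?thesis
      using assms by (simp add: orthonormal_basis_def)
  qed
  then have "span B = span UNIV" by auto
  with assms show ?thesis
    using dim_eq_card[OF _ orthonormal_independent] by (simp add: orthonormal_basis_def)
qed

lemma parseval:
  assumes "orthonormal_basis B"
  shows "to_complex (ip x y) = (\<Sum>b\<in>B. to_complex (ip x b) * cnj (to_complex (ip y b)))"
proof -
  have "ip x y = ip (\<Sum>b\<in>B. scale (ip x b) b) y"
    using assms by (simp add: orthonormal_basis_def)
  also have "\<dots> = (\<Sum>b\<in>B. ip x b * ip b y)"
    by (rule ip_sum_left)
  finally show ?thesis
    by (simp add: to_complex_sum to_complex_mult ip_conj_sym[of _ y, symmetric])
qed

lemma parseval_norm:
  assumes "orthonormal_basis B"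
  shows "(ip_norm ip x)\<^sup>2 = (\<Sum>b\<in>B. (norm (ip x b))\<^sup>2)"
proof -
  have "of_real ((ip_norm ip x)\<^sup>2) = (of_real (\<Sum>b\<in>B. (norm (ip x b))\<^sup>2) :: complex)"
    unfolding to_complex_ip_self[symmetric] parseval[OF assms, of x x]
    by (simp only: complex_norm_square[symmetric] norm_to_complex of_real_sum)
  then show ?thesis
    by (simp only: of_real_eq_iff)
qed

section \<open>Bessel families in coordinates\<close>

text \<open>
  Summing the Bessel integrals over an orthonormal basis integrates \<open>\<parallel>\<tau> \<alpha>\<parallel>\<^sup>2 = 1\<close>. Hence a normalized
  Bessel family can only live on a space of finite measure, and the frame bound of a tight family
  is the measure of the space divided by the dimension.
\<close>
lemma sum_frame_integrals:
  assumes "orthonormal_basis B" "continuous_Bessel_family M ip \<tau>" "normalized_family M ip \<tau>"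
  shows "(\<Sum>b\<in>B. frame_integral M ip \<tau> b) = emeasure M (space M)"
proof -
  have "(\<lambda>\<alpha>. ennreal ((norm (ip b (\<tau> \<alpha>)))\<^sup>2)) \<in> borel_measurable M" for b
    using assms(2) unfolding continuous_Bessel_family_def
    by (intro measurable_compose[OF _ measurable_ennreal] borel_measurable_power
        measurable_compose[OF _ borel_measurable_norm]) auto
  then have "(\<Sum>b\<in>B. frame_integral M ip \<tau> b) =
      (\<integral>\<^sup>+\<alpha>. (\<Sum>b\<in>B. ennreal ((norm (ip b (\<tau> \<alpha>)))\<^sup>2)) \<partial>M)"
    unfolding frame_integral_def by (intro nn_integral_sum[symmetric]) auto
  also have "\<dots> = (\<integral>\<^sup>+\<alpha>. 1 \<partial>M)"
  proof (rule nn_integral_cong)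
    fix \<alpha> assume "\<alpha> \<in> space M"
    then have "(\<Sum>b\<in>B. (norm (ip b (\<tau> \<alpha>)))\<^sup>2) = 1"
      using assms(3) parseval_norm[OF assms(1), of "\<tau> \<alpha>"]
      by (simp add: normalized_family_def norm_ip_commute[of _ "\<tau> \<alpha>"])
    then show "(\<Sum>b\<in>B. ennreal ((norm (ip b (\<tau> \<alpha>)))\<^sup>2)) = 1"
      by (simp add: sum_ennreal)
  qed
  finally show ?thesis by simp
qed

lemma unit_vector_field_coordinates:
  assumes "orthonormal_basis B" "continuous_Bessel_family M ip \<tau>" "normalized_family M ip \<tau>"
  shows "unit_vector_field M B (\<lambda>b \<alpha>. to_complex (ip (\<tau> \<alpha>) b))"
proof (intro unit_vector_field.intro unit_vector_field_axioms.intro finite_measureI)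
  obtain c where c: "\<And>h. frame_integral M ip \<tau> h \<le> ennreal (c * (ip_norm ip h)\<^sup>2)"
    using assms(2) unfolding continuous_Bessel_family_def by blast
  have "(\<Sum>b\<in>B. frame_integral M ip \<tau> b) \<noteq> \<infinity>"
  proof -
    have "(\<Sum>b\<in>B. frame_integral M ip \<tau> b) < top"
      using assms(1) le_less_trans[OF c ennreal_less_top]
      by (auto simp: orthonormal_basis_def ennreal_sum_less_top)
    then show ?thesis by simp
  qed
  then show "emeasure M (space M) \<noteq> \<infinity>"
    unfolding sum_frame_integrals[OF assms] .
  show "finite B"
    using assms(1) by (simp add: orthonormal_basis_def)
next
  fix b assume "b \<in> B"
  \<comment> \<open>Measurability is known with the family in the second argument.\<close>
  have "(\<lambda>\<alpha>. cnj (to_complex (ip b (\<tau> \<alpha>)))) \<in> borel_measurable M"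
    using assms(2) unfolding continuous_Bessel_family_def
    by (intro borel_measurable_continuous_on[where f = "\<lambda>z. cnj (to_complex z)"])
       (auto intro!: continuous_on_cnj continuous_on_to_complex)
  then show "(\<lambda>\<alpha>. to_complex (ip (\<tau> \<alpha>) b)) \<in> borel_measurable M"
    by (simp only: ip_conj_sym[symmetric])
next
  fix \<alpha> assume "\<alpha> \<in> space M"
  then show "(\<Sum>b\<in>B. (norm (to_complex (ip (\<tau> \<alpha>) b)))\<^sup>2) = 1"
    using assms(3) parseval_norm[OF assms(1), of "\<tau> \<alpha>"]
    by (simp add: norm_to_complex normalized_family_def)
qed

lemma norm_ip_eq_norm_pairing:
  assumes "orthonormal_basis B" "continuous_Bessel_family M ip \<tau>" "normalized_family M ip \<tau>"
  shows "norm (ip (\<tau> \<alpha>) (\<tau> \<beta>)) =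
    norm (unit_vector_field.pairing B (\<lambda>b \<alpha>. to_complex (ip (\<tau> \<alpha>) b)) \<alpha> \<beta>)"
proof -
  interpret U: unit_vector_field M B "\<lambda>b \<alpha>. to_complex (ip (\<tau> \<alpha>) b)"
    by (rule unit_vector_field_coordinates[OF assms])
  show ?thesis
    using parseval[OF assms(1), of "\<tau> \<alpha>" "\<tau> \<beta>"] norm_to_complex[of "ip (\<tau> \<alpha>) (\<tau> \<beta>)"]
    by (simp add: U.pairing_def)
qed

lemma tight_of_isotropic_coordinates:
  assumes "orthonormal_basis B" "continuous_Bessel_family M ip \<tau>" "normalized_family M ip \<tau>"
    and "c > 0"
    and "\<And>i j. i \<in> B \<Longrightarrow> j \<in> B \<Longrightarrow>
      (\<integral>\<alpha>. to_complex (ip (\<tau> \<alpha>) i) * cnj (to_complex (ip (\<tau> \<alpha>) j)) \<partial>M) =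
      (if i = j then of_real c else 0)"
  shows "tight_continuous_frame M ip \<tau>"
proof -
  interpret U: unit_vector_field M B "\<lambda>b \<alpha>. to_complex (ip (\<tau> \<alpha>) b)"
    by (rule unit_vector_field_coordinates[OF assms(1-3)])
  have "frame_integral M ip \<tau> h = ennreal (c * (ip_norm ip h)\<^sup>2)" for h
  proof -
    have "norm (ip h (\<tau> \<alpha>)) =
        norm (\<Sum>b\<in>B. to_complex (ip h b) * cnj (to_complex (ip (\<tau> \<alpha>) b)))" for \<alpha>
      unfolding parseval[OF assms(1), symmetric] norm_to_complex by (rule refl)
    then show ?thesis
      unfolding frame_integral_def parseval_norm[OF assms(1)]
      using U.nn_integral_linear_form[OF assms(5), of "\<lambda>b. to_complex (ip h b)"]
      by (simp add: norm_to_complex)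
  qed
  with assms(2,4) show ?thesis
    unfolding tight_continuous_frame_def continuous_Bessel_family_def by auto
qed

text \<open>
  The inner integral is the frame integral of the unit vector \<open>\<tau> \<beta>\<close>, which is the frame bound
  itself.
\<close>
lemma first_frame_potential_of_tight:
  assumes "orthonormal_basis B" "continuous_Bessel_family M ip \<tau>" "normalized_family M ip \<tau>"
    and "tight_continuous_frame M ip \<tau>" and "B \<noteq> {}"
  shows "(\<integral>\<^sup>+\<beta>. (\<integral>\<^sup>+\<alpha>. ennreal ((norm (ip (\<tau> \<alpha>) (\<tau> \<beta>)))\<^sup>2) \<partial>M) \<partial>M) =
    (emeasure M (space M))\<^sup>2 / of_nat (card B)"
proof -
  obtain a where a: "a > 0" "\<And>h. frame_integral M ip \<tau> h = ennreal (a * (ip_norm ip h)\<^sup>2)"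
    using assms(4) unfolding tight_continuous_frame_def by (blast intro: antisym)
  have B: "card B \<noteq> 0" "finite B"
    using assms(1,5) by (auto simp: orthonormal_basis_def)
  have "ip_norm ip b = 1" if "b \<in> B" for b
    using assms(1) that by (simp add: orthonormal_basis_def orthonormal_def ip_norm_def)
  then have "emeasure M (space M) = (\<Sum>b\<in>B. ennreal a)"
    unfolding sum_frame_integrals[OF assms(1-3), symmetric] a(2) by simp
  then have M: "emeasure M (space M) = ennreal (a * card B)"
    using a(1) by (simp add: ennreal_of_nat_eq_real_of_nat ennreal_mult mult.commute)
  have "(\<integral>\<^sup>+\<beta>. (\<integral>\<^sup>+\<alpha>. ennreal ((norm (ip (\<tau> \<alpha>) (\<tau> \<beta>)))\<^sup>2) \<partial>M) \<partial>M) =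
      (\<integral>\<^sup>+\<beta>. frame_integral M ip \<tau> (\<tau> \<beta>) \<partial>M)"
    unfolding frame_integral_def by (simp only: norm_ip_commute)
  also have "\<dots> = (\<integral>\<^sup>+\<beta>. ennreal a \<partial>M)"
    unfolding a(2) using assms(3) by (intro nn_integral_cong) (simp add: normalized_family_def)
  also have "\<dots> = ennreal (a * (a * card B))"
    using a(1) by (simp add: M ennreal_mult)
  also have "a * (a * card B) = (a * card B)\<^sup>2 / card B"
    using B by (simp add: power2_eq_square)
  also have "ennreal \<dots> = (emeasure M (space M))\<^sup>2 / of_nat (card B)"
    using a(1) B unfolding M
    by (simp add: ennreal_power divide_ennreal ennreal_of_nat_eq_real_of_nat card_gt_0_iff)
  finally show ?thesis .
qed

lemma norm_ip_dim_1:
  assumes "orthonormal_basis B" "card B = 1" "ip_norm ip x = 1" "ip_norm ip y = 1"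
  shows "norm (ip x y) = 1"
proof -
  obtain b where b: "B = {b}"
    using assms(2) card_1_singletonE by blast
  have "norm (ip x b) = 1" "norm (ip y b) = 1"
    using parseval_norm[OF assms(1), of x] parseval_norm[OF assms(1), of y] assms(3,4)
    by (simp_all add: b abs_square_eq_1)
  then show ?thesis
    using parseval[OF assms(1), of x y] norm_to_complex[of "ip x y"]
    by (simp add: b norm_mult norm_to_complex)
qed

end

section \<open>Higher order continuous Welch bounds\<close>

theorem theorem2p7:
  fixes scale :: "'k::real_or_complex \<Rightarrow> 'h::ab_group_add \<Rightarrow> 'h"
    and ip :: "'h \<Rightarrow> 'h \<Rightarrow> 'k"
    and d :: nat
    and M :: "'a measure"
    and \<tau> :: "'a \<Rightarrow> 'h"
  assumes "finite_dim_hilbert_space scale ip"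
    and "vector_space.dim scale (UNIV :: 'h set) = d"
    and "continuous_Bessel_family M ip \<tau>"
    and "normalized_family M ip \<tau>"
    and "diagonal M \<in> sets (M \<Otimes>\<^sub>M M)"
  shows
    "(\<forall>m::nat.
        (\<integral>\<^sup>+(\<alpha>, \<beta>). ennreal (norm (ip (\<tau> \<alpha>) (\<tau> \<beta>)) ^ (2 * m)) \<partial>(M \<Otimes>\<^sub>M M))
          = (\<integral>\<^sup>+\<beta>. (\<integral>\<^sup>+\<alpha>. ennreal (norm (ip (\<tau> \<alpha>) (\<tau> \<beta>)) ^ (2 * m)) \<partial>M) \<partial>M)
        \<and> (\<integral>\<^sup>+\<beta>. (\<integral>\<^sup>+\<alpha>. ennreal (norm (ip (\<tau> \<alpha>) (\<tau> \<beta>)) ^ (2 * m)) \<partial>M) \<partial>M)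
          \<ge> (emeasure M (space M))\<^sup>2 / of_nat ((d + m - 1) choose m))
     \<and> (emeasure M (space M) \<noteq> 0 \<longrightarrow>
        (\<forall>m\<ge>1.
          ((\<integral>\<^sup>+\<beta>. (\<integral>\<^sup>+\<alpha>. ennreal (norm (ip (\<tau> \<alpha>) (\<tau> \<beta>)) ^ (2 * m)) \<partial>M) \<partial>M)
             = (emeasure M (space M))\<^sup>2 / of_nat ((d + m - 1) choose m)
           \<longrightarrow> tight_continuous_frame M ip \<tau>)
          \<and> (m = 1 \<or> d = 1 \<longrightarrow>
             ((\<integral>\<^sup>+\<beta>. (\<integral>\<^sup>+\<alpha>. ennreal (norm (ip (\<tau> \<alpha>) (\<tau> \<beta>)) ^ (2 * m)) \<partial>M) \<partial>M)
             = (emeasure M (space M))\<^sup>2 / of_nat ((d + m - 1) choose m)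
             \<longleftrightarrow> tight_continuous_frame M ip \<tau>))))
     \<and> (measure (M \<Otimes>\<^sub>M M) (space M \<times> space M - diagonal M) \<noteq> 0 \<longrightarrow>
        (\<forall>m::nat.
          (SUP (\<alpha>, \<beta>)\<in>space M \<times> space M - diagonal M. norm (ip (\<tau> \<alpha>) (\<tau> \<beta>)) ^ (2 * m))
          \<ge> 1 / measure (M \<Otimes>\<^sub>M M) (space M \<times> space M - diagonal M)
             * ((measure M (space M))\<^sup>2 / real ((d + m - 1) choose m)
                - measure (M \<Otimes>\<^sub>M M) (diagonal M))))"
proof -
  interpret H: finite_dim_hilbert_space scale ip by fact
  obtain B where B: "H.orthonormal_basis B"
    using H.orthonormal_basis_exists by blast
  have d: "card B = d"
    using H.card_orthonormal_basis[OF B] assms(2) by simp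
  note Bessel = B assms(3,4)
  interpret U: unit_vector_field M B "\<lambda>b \<alpha>. to_complex (ip (\<tau> \<alpha>) b)"
    by (rule H.unit_vector_field_coordinates[OF Bessel])
  note pairing = H.norm_ip_eq_norm_pairing[OF Bessel]
  have dim_sym: "U.dim_sym m = (d + m - 1) choose m" for m
    by (simp add: U.dim_sym_def d)
  note Fubini = U.iterated_integral_eq[folded pairing]
  show ?thesis
  proof (cases "B = {}")
    \<comment> \<open>In dimension 0 there are no unit vectors, and both sides vanish. This case is separate
      because the binomial coefficient is 0 for positive \<open>m\<close>.\<close>
    case True
    then have empty: "space M = {}"
      using U.unit by fastforce
    then have "diagonal M = {}"
      by (auto simp: diagonal_def)
    then show ?thesis
      using Fubini by (simp add: empty)
  next
    case False
    note bound = U.welch_bound[OF False, folded pairing, unfolded dim_sym]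
    note sup = U.sup_welch_bound[OF False assms(5), folded pairing, unfolded dim_sym]
    have tight: "tight_continuous_frame M ip \<tau>"
      if nz: "emeasure M (space M) \<noteq> 0" and m: "m \<ge> 1" and
        eq: "(\<integral>\<^sup>+\<beta>. (\<integral>\<^sup>+\<alpha>. ennreal (norm (ip (\<tau> \<alpha>) (\<tau> \<beta>)) ^ (2 * m)) \<partial>M) \<partial>M)
             = (emeasure M (space M))\<^sup>2 / of_nat ((d + m - 1) choose m)" for m
    proof (rule H.tight_of_isotropic_coordinates[OF Bessel])
      show "measure M (space M) / real (card B) > 0"
        using nz False U.finite_I
        by (simp add: U.emeasure_eq_measure card_gt_0_iff zero_less_measure_iff)
      show "(\<integral>\<alpha>. to_complex (ip (\<tau> \<alpha>) i) * cnj (to_complex (ip (\<tau> \<alpha>) j)) \<partial>M) =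
          (if i = j then of_real (measure M (space M) / real (card B)) else 0)"
        if "i \<in> B" "j \<in> B" for i j
        by (rule U.isotropic_of_welch_equality[OF False m _ that])
           (simp only: pairing[symmetric] dim_sym eq)
    qed
    have equality: "(\<integral>\<^sup>+\<beta>. (\<integral>\<^sup>+\<alpha>. ennreal (norm (ip (\<tau> \<alpha>) (\<tau> \<beta>)) ^ (2 * m)) \<partial>M) \<partial>M)
             = (emeasure M (space M))\<^sup>2 / of_nat ((d + m - 1) choose m)"
      if "tight_continuous_frame M ip \<tau>" "m = 1 \<or> d = 1" for m
      using that(2)
    proof
      assume "m = 1"
      then show ?thesis
        using H.first_frame_potential_of_tight[OF Bessel that(1) False] d by simp
    next
      assume "d = 1"
      then have "norm (ip (\<tau> \<alpha>) (\<tau> \<beta>)) = 1" if "\<alpha> \<in> space M" "\<beta> \<in> space M" for \<alpha> \<beta>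
        using H.norm_ip_dim_1[OF B] d assms(4) that by (simp add: normalized_family_def)
      then have "(\<integral>\<^sup>+\<beta>. (\<integral>\<^sup>+\<alpha>. ennreal (norm (ip (\<tau> \<alpha>) (\<tau> \<beta>)) ^ (2 * m)) \<partial>M) \<partial>M) =
          (\<integral>\<^sup>+\<beta>. (\<integral>\<^sup>+\<alpha>. 1 \<partial>M) \<partial>M)"
        by (intro nn_integral_cong) simp
      then show ?thesis
        by (simp add: \<open>d = 1\<close> power2_eq_square divide_ennreal_def)
    qed
    show ?thesis
      by (intro conjI allI impI iffI)
         (rule Fubini[symmetric] bound | (rule sup tight equality; assumption))+
  qed
qed

end
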